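(* Let $w \in W$ be any scenario, and let $\mathbf{z} = (z_i)_{i\in I}$ and $\mathbf{x} = (x_{ik})_{i \in I, k\in K}$ be given first-stage decisions (so that they appear only in right-hand sides). Consider the second-stage problem in the variables $(y_{akw})_{a \in A, k \in K}$: $$\theta_{w}(\mathbf{z},\mathbf{x}) = \max \sum_{a \in A} \sum_{k \in K} r_{ak} y_{akw}$$ subject to $$\sum_{a \in \sigma^+(n_{it})} y_{akw} - \sum_{a \in \sigma^-(n_{it})} y_{akw} = \begin{cases} x_{ik} & \text{if } t=0 \\ 0 & \text{if } t \in \{1,\ldots, T-1\} \\ -x_{ik} & \text{if } t=T \end{cases} \quad \forall i \in I,\ \forall k \in K,\ \forall t \in \{0,\ldots,T\},$$ $$y_{akw} \leq u_{akw} z_{i} \quad \forall a=(n_{it},n_{is}) \in A^{two},\ \forall k \in K,$$ $$y_{akw} \leq u_{akw} z_{i} \quad \forall a=(n_{it},n_{js}) \in A^{one},\ \forall k \in K,$$ $$y_{akw} \leq u_{akw} z_{j} \quad \forall a=(n_{it},n_{js}) \in A^{one},\ \forall k \in K,$$ $$y_{akw} \leq C_i^k z_{i} \quad \forall a=(n_{it},n_{i,t+1}) \in A^{idle},\ \forall k \in K,$$ $$y_{akw} \in \mathbb{Z}^{+} \quad \forall a \in A,\ \forall k \in K.$$ Then the constraint matrix of this problem is totally unimodular, where the constraint matrix is the coefficient matrix of the variables $y_{akw}$ whose rows are: one row for each flow balance equality (indexed by $i \in I$, $k \in K$, $t \in \{0,\ldots,T\}$), one row for each inequality $y_{akw} \leq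 u_{akw} z_i$ with $a=(n_{it},n_{is}) \in A^{two}$, $k \in K$, one row for each inequality $y_{akw} \leq u_{akw} z_i$ and one row for each inequality $y_{akw} \leq u_{akw} z_j$ with $a=(n_{it},n_{js}) \in A^{one}$, $k \in K$, and one row for each inequality $y_{akw} \leq C_i^k z_i$ with $a=(n_{it},n_{i,t+1}) \in A^{idle}$, $k \in K$.
   Context: $I$ is a finite set of regions, $K$ a finite set of car types, $T \ge 1$ an integer number of time periods, and $W$ a finite set of scenarios. $\mathbb{Z}^+$ denotes the nonnegative integers. Spatial-temporal network: $G=(N,A)$ is a directed multigraph with node set $N = \{n_{it} : i \in I,\ t \in \{0,1,\ldots,T\}\}$. The arc set $A$ is the union of four sets of arcs (arcs belonging to different sets are regarded as distinct even if they have the same endpoints): - $A^{one}$ (one-way arcs): arcs of the form $(n_{it},n_{js})$ with $i \ne j$ in $I$ and $0 \le t < s \le T$; - $A^{two}$ (round-trip arcs): arcs of the form $(n_{it},n_{is})$ with $i \in I$ and $0 \le t<s \le T$; - $A^{rel}$ (relocation arcs): arcs of the form $(n_{it},n_{j,t+\zeta_{ij}})$ with $i \neq j$ in $I$ and $t+\zeta_{ij}\le T$, where $\zeta_{ij}$ is a positive integer travel time; - $A^{idle}$ (idle arcs): arcs of the form $(n_{it},n_{i,t+1})$ with $i\in I$ and $t \in \{0,\ldots,T-1\}$. $\sigma^+(n_{it})$ is the set of arcs in $A$ with origin $n_{it}$, and $\sigma^-(n_{it})$ is the set of arcs in $A$ with destination $n_{it}$. Data: $z_i \in\{0,1\}$;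 $x_{ik}$ are nonnegative integers; $C_i^k$ is the parking capacity of region $i$ for car type $k$ (a nonnegative integer); $u_{akw}$ is a nonnegative integer (the customer demand for car type $k$ on the one-way or round-trip arc $a$ in scenario $w$); $r_{ak}$ is a real unit revenue. A matrix is totally unimodular if every square submatrix has determinant in $\{-1,0,1\}$. *)

theory Defs
  imports
    "Graph_Theory.Digraph"
    "Jordan_Normal_Form.Determinant"
    "HOL-Library.Extended_Real"
begin

section \<open>Totally unimodular matrices\<close>

text \<open>
  A matrix with finite row index set R and column index set C is a function on R and C. A square
  submatrix is given by injective choices of n rows and n columns, in any order; the order affects
  only the sign of the determinant.
\<close>

definition totally_unimodular :: "'r set \<Rightarrow> 'c set \<Rightarrow> ('r \<Rightarrow> 'c \<Rightarrow> int) \<Rightarrow> bool" where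
  "totally_unimodular R C M \<longleftrightarrow>
     (\<forall>n rs cs. rs ` {..<n} \<subseteq> R \<longrightarrow> inj_on rs {..<n} \<longrightarrow>
                cs ` {..<n} \<subseteq> C \<longrightarrow> inj_on cs {..<n} \<longrightarrow>
                det (mat n n (\<lambda>(p, q). M (rs p) (cs q))) \<in> {-1, 0, 1})"


section \<open>Integer linear programs in nonnegative variables\<close>

datatype constraint_sense = Equality | LessEqual

record ('r, 'c) integer_program =
  ip_rows :: "'r set"
  ip_cols :: "'c set"
  ip_objective :: "'c \<Rightarrow> real"
  ip_matrix :: "'r \<Rightarrow> 'c \<Rightarrow> int"
  ip_sense :: "'r \<Rightarrow> constraint_sense"
  ip_rhs :: "'r \<Rightarrow> int"

definition ip_satisfies :: "('r, 'c) integer_program \<Rightarrow> ('c \<Rightarrow> int) \<Rightarrow> 'r \<Rightarrow> bool" where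
  "ip_satisfies P y \<rho> \<longleftrightarrow>
     (case ip_sense P \<rho> of
        Equality \<Rightarrow> (\<Sum>c\<in>ip_cols P. ip_matrix P \<rho> c * y c) = ip_rhs P \<rho>
      | LessEqual \<Rightarrow> (\<Sum>c\<in>ip_cols P. ip_matrix P \<rho> c * y c) \<le> ip_rhs P \<rho>)"

definition ip_feasible :: "('r, 'c) integer_program \<Rightarrow> ('c \<Rightarrow> int) \<Rightarrow> bool" where
  "ip_feasible P y \<longleftrightarrow> (\<forall>\<rho>\<in>ip_rows P. ip_satisfies P y \<rho>) \<and> (\<forall>c\<in>ip_cols P. 0 \<le> y c)"

text \<open>The value of the maximization problem; it is \<open>-\<infinity>\<close> if the problem is infeasible.\<close>

definition ip_value :: "('r, 'c) integer_program \<Rightarrow> ereal" where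
  "ip_value P =
     (SUP y\<in>{y. ip_feasible P y}. ereal (\<Sum>c\<in>ip_cols P. ip_objective P c * real_of_int (y c)))"


section \<open>The spatial-temporal network\<close>

text \<open>
  The node \<open>n\<^sub>i\<^sub>t\<close> is the pair \<open>(i, t)\<close>. Arcs are abstract objects with a tail and a head, so arcs
  with the same endpoints may be distinct. The components \<open>demand\<close>, \<open>capacity\<close> and \<open>revenue\<close> are
  the data \<open>u\<close>, \<open>C\<close> and \<open>r\<close>.
\<close>

record ('i, 'k, 'w, 'a) sharing_data =
  regions :: "'i set"
  car_types :: "'k set"
  scenarios :: "'w set"
  horizon :: nat
  network :: "('i \<times> nat, 'a) pre_digraph"
  one_way :: "'a set"
  round_trip :: "'a set"
  relocation :: "'a set"
  idle :: "'a set"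
  travel_time :: "'i \<Rightarrow> 'i \<Rightarrow> nat"
  demand :: "'a \<Rightarrow> 'k \<Rightarrow> 'w \<Rightarrow> nat"
  capacity :: "'i \<Rightarrow> 'k \<Rightarrow> nat"
  revenue :: "'a \<Rightarrow> 'k \<Rightarrow> real"

locale car_sharing = fin_digraph "network D"
  for D :: "('i, 'k, 'w, 'a) sharing_data" +
  assumes finite_regions: "finite (regions D)"
    and finite_car_types: "finite (car_types D)"
    and finite_scenarios: "finite (scenarios D)"
    and horizon_ge_1: "horizon D \<ge> 1"
    and nodes: "verts (network D) = regions D \<times> {0..horizon D}"
    and arcs_union: "arcs (network D) = one_way D \<union> round_trip D \<union> relocation D \<union> idle D"
    and arcs_disjoint:
      "one_way D \<inter> round_trip D = {}" "one_way D \<inter> relocation D = {}" "one_way D \<inter> idle D = {}"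
      "round_trip D \<inter> relocation D = {}" "round_trip D \<inter> idle D = {}" "relocation D \<inter> idle D = {}"
    and travel_time_pos:
      "\<And>i j. i \<in> regions D \<Longrightarrow> j \<in> regions D \<Longrightarrow> i \<noteq> j \<Longrightarrow> travel_time D i j > 0"
    and one_way_arc: "\<And>a. a \<in> one_way D \<Longrightarrow>
      \<exists>i\<in>regions D. \<exists>j\<in>regions D. \<exists>t s. i \<noteq> j \<and> t < s \<and> s \<le> horizon D \<and>
        tail (network D) a = (i, t) \<and> head (network D) a = (j, s)"
    and round_trip_arc: "\<And>a. a \<in> round_trip D \<Longrightarrow>
      \<exists>i\<in>regions D. \<exists>t s. t < s \<and> s \<le> horizon D \<and>
        tail (network D) a = (i, t) \<and> head (network D) a = (i, s)"
    and relocation_arc: "\<And>a. a \<in> relocation D \<Longrightarrow>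
      \<exists>i\<in>regions D. \<exists>j\<in>regions D. \<exists>t. i \<noteq> j \<and> t + travel_time D i j \<le> horizon D \<and>
        tail (network D) a = (i, t) \<and> head (network D) a = (j, t + travel_time D i j)"
    and idle_arc: "\<And>a. a \<in> idle D \<Longrightarrow>
      \<exists>i\<in>regions D. \<exists>t<horizon D.
        tail (network D) a = (i, t) \<and> head (network D) a = (i, t + 1)"


section \<open>The second-stage problem\<close>

text \<open>
  A one-way arc has two rows per car type, one for the opening decision at each of its endpoints.
\<close>

datatype ('i, 'k, 'a) second_stage_row =
    Flow_Balance 'i 'k nat
  | Round_Trip_Bound 'a 'k
  | One_Way_Origin_Bound 'a 'k
  | One_Way_Destination_Bound 'a 'k
  | Idle_Bound 'a 'k

definition second_stage_rows ::
    "('i, 'k, 'w, 'a) sharing_data \<Rightarrow> ('i, 'k, 'a) second_stage_row set" where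
  "second_stage_rows D =
     {Flow_Balance i k t | i k t. i \<in> regions D \<and> k \<in> car_types D \<and> t \<in> {0..horizon D}} \<union>
     {Round_Trip_Bound a k | a k. a \<in> round_trip D \<and> k \<in> car_types D} \<union>
     {One_Way_Origin_Bound a k | a k. a \<in> one_way D \<and> k \<in> car_types D} \<union>
     {One_Way_Destination_Bound a k | a k. a \<in> one_way D \<and> k \<in> car_types D} \<union>
     {Idle_Bound a k | a k. a \<in> idle D \<and> k \<in> car_types D}"

text \<open>The column \<open>(a, k)\<close> belongs to the variable \<open>y\<^sub>a\<^sub>k\<^sub>w\<close> of the fixed scenario \<open>w\<close>.\<close>

fun second_stage_coeff ::
    "('i, 'k, 'w, 'a) sharing_data \<Rightarrow> ('i, 'k, 'a) second_stage_row \<Rightarrow> 'a \<times> 'k \<Rightarrow> int" where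
  "second_stage_coeff D (Flow_Balance i k t) (a, l) =
     (if l = k
      then of_bool (a \<in> out_arcs (network D) (i, t)) - of_bool (a \<in> in_arcs (network D) (i, t))
      else 0)"
| "second_stage_coeff D (Round_Trip_Bound b k) c = of_bool (c = (b, k))"
| "second_stage_coeff D (One_Way_Origin_Bound b k) c = of_bool (c = (b, k))"
| "second_stage_coeff D (One_Way_Destination_Bound b k) c = of_bool (c = (b, k))"
| "second_stage_coeff D (Idle_Bound b k) c = of_bool (c = (b, k))"

fun second_stage_sense :: "('i, 'k, 'a) second_stage_row \<Rightarrow> constraint_sense" where
  "second_stage_sense (Flow_Balance i k t) = Equality"
| "second_stage_sense _ = LessEqual"

fun second_stage_rhs ::
    "('i, 'k, 'w, 'a) sharing_data \<Rightarrow> 'w \<Rightarrow> ('i \<Rightarrow> nat) \<Rightarrow> ('i \<Rightarrow> 'k \<Rightarrow> nat) \<Rightarrow>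
     ('i, 'k, 'a) second_stage_row \<Rightarrow> int" where
  "second_stage_rhs D w z x (Flow_Balance i k t) =
     (if t = 0 then int (x i k) else if t = horizon D then - int (x i k) else 0)"
| "second_stage_rhs D w z x (Round_Trip_Bound a k) =
     int (demand D a k w * z (fst (tail (network D) a)))"
| "second_stage_rhs D w z x (One_Way_Origin_Bound a k) =
     int (demand D a k w * z (fst (tail (network D) a)))"
| "second_stage_rhs D w z x (One_Way_Destination_Bound a k) =
     int (demand D a k w * z (fst (head (network D) a)))"
| "second_stage_rhs D w z x (Idle_Bound a k) =
     int (capacity D (fst (tail (network D) a)) k * z (fst (tail (network D) a)))"

definition second_stage ::
    "('i, 'k, 'w, 'a) sharing_data \<Rightarrow> 'w \<Rightarrow> ('i \<Rightarrow> nat) \<Rightarrow> ('i \<Rightarrow> 'k \<Rightarrow> nat) \<Rightarrow>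
     (('i, 'k, 'a) second_stage_row, 'a \<times> 'k) integer_program" where
  "second_stage D w z x =
     \<lparr>ip_rows = second_stage_rows D,
      ip_cols = arcs (network D) \<times> car_types D,
      ip_objective = (\<lambda>(a, k). revenue D a k),
      ip_matrix = second_stage_coeff D,
      ip_sense = second_stage_sense,
      ip_rhs = second_stage_rhs D w z x\<rparr>"

text \<open>The value \<open>\<theta>\<^sub>w(z, x)\<close>.\<close>

definition theta ::
    "('i, 'k, 'w, 'a) sharing_data \<Rightarrow> 'w \<Rightarrow> ('i \<Rightarrow> nat) \<Rightarrow> ('i \<Rightarrow> 'k \<Rightarrow> nat) \<Rightarrow> ereal" where
  "theta D w z x = ip_value (second_stage D w z x)"

text \<open>Feasibility in terms of the coefficients is the usual system of constraints.\<close>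

lemma (in car_sharing) ip_feasible_second_stage_iff:
  fixes z :: "'i \<Rightarrow> nat" and x :: "'i \<Rightarrow> 'k \<Rightarrow> nat" and y :: "'a \<times> 'k \<Rightarrow> int" and w :: 'w
  shows "ip_feasible (second_stage D w z x) y \<longleftrightarrow>
    (\<forall>i\<in>regions D. \<forall>k\<in>car_types D. \<forall>t\<in>{0..horizon D}.
       (\<Sum>a\<in>out_arcs (network D) (i, t). y (a, k)) - (\<Sum>a\<in>in_arcs (network D) (i, t). y (a, k)) =
       (if t = 0 then int (x i k) else if t = horizon D then - int (x i k) else 0)) \<and>
    (\<forall>a\<in>round_trip D. \<forall>k\<in>car_types D.
       y (a, k) \<le> int (demand D a k w * z (fst (tail (network D) a)))) \<and>
    (\<forall>a\<in>one_way D. \<forall>k\<in>car_types D.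
       y (a, k) \<le> int (demand D a k w * z (fst (tail (network D) a)))) \<and>
    (\<forall>a\<in>one_way D. \<forall>k\<in>car_types D.
       y (a, k) \<le> int (demand D a k w * z (fst (head (network D) a)))) \<and>
    (\<forall>a\<in>idle D. \<forall>k\<in>car_types D.
       y (a, k) \<le> int (capacity D (fst (tail (network D) a)) k * z (fst (tail (network D) a)))) \<and>
    (\<forall>a\<in>arcs (network D). \<forall>k\<in>car_types D. 0 \<le> y (a, k))"
proof -
  have fin: "finite (arcs (network D) \<times> car_types D)"
    using finite_car_types by simp
  have unit: "(\<Sum>c\<in>arcs (network D) \<times> car_types D. of_bool (c = (b, k)) * y c) = y (b, k)"
    if "b \<in> arcs (network D)" "k \<in> car_types D" for b k
  proof -
    have "(\<Sum>c\<in>arcs (network D) \<times> car_types D. of_bool (c = (b, k)) * y c) =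
          (\<Sum>c\<in>arcs (network D) \<times> car_types D. if c = (b, k) then y c else 0)"
      by (intro sum.cong) auto
    then show ?thesis
      using that fin by (simp add: sum.delta)
  qed
  have flow: "(\<Sum>c\<in>arcs (network D) \<times> car_types D. second_stage_coeff D (Flow_Balance i k t) c * y c) =
      (\<Sum>a\<in>out_arcs (network D) (i, t). y (a, k)) - (\<Sum>a\<in>in_arcs (network D) (i, t). y (a, k))"
    if "k \<in> car_types D" for i k t
  proof -
    have "(\<Sum>c\<in>arcs (network D) \<times> car_types D. second_stage_coeff D (Flow_Balance i k t) c * y c) =
      (\<Sum>a\<in>arcs (network D). \<Sum>l\<in>car_types D. second_stage_coeff D (Flow_Balance i k t) (a, l) * y (a, l))"
      unfolding sum.cartesian_product by (intro sum.cong) auto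
    also have "\<dots> = (\<Sum>a\<in>arcs (network D). \<Sum>l\<in>car_types D. if l = k then
        (of_bool (a \<in> out_arcs (network D) (i, t)) - of_bool (a \<in> in_arcs (network D) (i, t))) * y (a, l) else 0)"
      by (intro sum.cong) auto
    also have "\<dots> = (\<Sum>a\<in>arcs (network D).
        (of_bool (a \<in> out_arcs (network D) (i, t)) - of_bool (a \<in> in_arcs (network D) (i, t))) * y (a, k))"
      using that finite_car_types by (simp add: sum.delta)
    also have "\<dots> = (\<Sum>a\<in>arcs (network D). if a \<in> out_arcs (network D) (i, t) then y (a, k) else 0) -
        (\<Sum>a\<in>arcs (network D). if a \<in> in_arcs (network D) (i, t) then y (a, k) else 0)"
      unfolding sum_subtractf[symmetric] by (intro sum.cong) auto
    also have "\<dots> = (\<Sum>a\<in>arcs (network D) \<inter> out_arcs (network D) (i, t). y (a, k)) -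
        (\<Sum>a\<in>arcs (network D) \<inter> in_arcs (network D) (i, t). y (a, k))"
      by (simp add: sum.inter_restrict)
    also have "arcs (network D) \<inter> out_arcs (network D) (i, t) = out_arcs (network D) (i, t)"
      by (auto simp: out_arcs_def)
    also have "arcs (network D) \<inter> in_arcs (network D) (i, t) = in_arcs (network D) (i, t)"
      by (auto simp: in_arcs_def)
    finally show ?thesis .
  qed
  have rows: "(\<forall>\<rho>\<in>second_stage_rows D. Q \<rho>) \<longleftrightarrow>
    (\<forall>i\<in>regions D. \<forall>k\<in>car_types D. \<forall>t\<in>{0..horizon D}. Q (Flow_Balance i k t)) \<and>
    (\<forall>a\<in>round_trip D. \<forall>k\<in>car_types D. Q (Round_Trip_Bound a k)) \<and>
    (\<forall>a\<in>one_way D. \<forall>k\<in>car_types D. Q (One_Way_Origin_Bound a k)) \<and>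
    (\<forall>a\<in>one_way D. \<forall>k\<in>car_types D. Q (One_Way_Destination_Bound a k)) \<and>
    (\<forall>a\<in>idle D. \<forall>k\<in>car_types D. Q (Idle_Bound a k))" for Q
    unfolding second_stage_rows_def by blast
  have sub: "round_trip D \<subseteq> arcs (network D)" "one_way D \<subseteq> arcs (network D)" "idle D \<subseteq> arcs (network D)"
    using arcs_union by auto
  have sat: "ip_satisfies (second_stage D w z x) y \<rho> \<longleftrightarrow>
     (case second_stage_sense \<rho> of
        Equality \<Rightarrow> (\<Sum>c\<in>arcs (network D) \<times> car_types D. second_stage_coeff D \<rho> c * y c) = second_stage_rhs D w z x \<rho>
      | LessEqual \<Rightarrow> (\<Sum>c\<in>arcs (network D) \<times> car_types D. second_stage_coeff D \<rho> c * y c) \<le> second_stage_rhs D w z x \<rho>)" for \<rho>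
    by (cases "second_stage_sense \<rho>") (simp_all add: ip_satisfies_def second_stage_def)
  have flow_row: "ip_satisfies (second_stage D w z x) y (Flow_Balance i k t) \<longleftrightarrow>
       (\<Sum>a\<in>out_arcs (network D) (i, t). y (a, k)) - (\<Sum>a\<in>in_arcs (network D) (i, t). y (a, k)) =
       (if t = 0 then int (x i k) else if t = horizon D then - int (x i k) else 0)"
    if "k \<in> car_types D" for i k t
    unfolding sat by (simp only: second_stage_sense.simps constraint_sense.case flow[OF that] second_stage_rhs.simps)
  have bounds:
    "ip_satisfies (second_stage D w z x) y (Round_Trip_Bound a k) \<longleftrightarrow>
       y (a, k) \<le> int (demand D a k w * z (fst (tail (network D) a)))"
    "ip_satisfies (second_stage D w z x) y (One_Way_Origin_Bound a k) \<longleftrightarrow>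
       y (a, k) \<le> int (demand D a k w * z (fst (tail (network D) a)))"
    "ip_satisfies (second_stage D w z x) y (One_Way_Destination_Bound a k) \<longleftrightarrow>
       y (a, k) \<le> int (demand D a k w * z (fst (head (network D) a)))"
    "ip_satisfies (second_stage D w z x) y (Idle_Bound a k) \<longleftrightarrow>
       y (a, k) \<le> int (capacity D (fst (tail (network D) a)) k * z (fst (tail (network D) a)))"
    if "a \<in> arcs (network D)" "k \<in> car_types D" for a k
    unfolding sat by (simp_all only: second_stage_sense.simps constraint_sense.case
        second_stage_coeff.simps unit[OF that] second_stage_rhs.simps)
  have nonneg: "(\<forall>c\<in>ip_cols (second_stage D w z x). 0 \<le> y c) \<longleftrightarrow>
      (\<forall>a\<in>arcs (network D). \<forall>k\<in>car_types D. 0 \<le> y (a, k))"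
    by (auto simp: second_stage_def)
  have rows_eq: "ip_rows (second_stage D w z x) = second_stage_rows D"
    by (simp add: second_stage_def)
  show ?thesis
    unfolding ip_feasible_def rows_eq rows nonneg
    using flow_row bounds sub by (simp add: subset_iff Ball_def)
qed

end

(*
  A square submatrix with a row or a column having at most one nonzero entry is reduced to a smaller
  one by Laplace expansion. In any other square submatrix there are no bound rows, and every column
  contains exactly the entries 1 and -1 of one arc, so the rows sum to zero and the determinant
  vanishes.
*)
theory Submission
  imports Defs
begin

text \<open>Laplace expansion along row \<open>i\<close>, where only the term of column
  \<open>j\<close> survives.\<close>

lemma det_eq_single_row_entry:
  fixes A :: "'a :: comm_ring_1 mat"
  assumes "A \<in> carrier_mat n n" and "i < n" and "j < n"
    and "\<And>q. q < n \<Longrightarrow> q \<noteq> j \<Longrightarrow> A $$ (i, q) = 0"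
  shows "det A = A $$ (i, j) * cofactor A i j"
proof -
  have "det A = (\<Sum>q<n. A $$ (i, q) * cofactor A i q)"
    using assms(1,2) by (rule laplace_expansion_row)
  also have "\<dots> = (\<Sum>q<n. if q = j then A $$ (i, q) * cofactor A i q else 0)"
    using assms(4) by (intro sum.cong) auto
  finally show ?thesis
    using assms(3) by simp
qed

lemma det_eq_single_col_entry:
  fixes A :: "'a :: comm_ring_1 mat"
  assumes "A \<in> carrier_mat n n" and "i < n" and "j < n"
    and "\<And>p. p < n \<Longrightarrow> p \<noteq> i \<Longrightarrow> A $$ (p, j) = 0"
  shows "det A = A $$ (i, j) * cofactor A i j"
proof -
  have "det A = (\<Sum>p<n. A $$ (p, j) * cofactor A p j)"
    using assms(1,3) by (rule laplace_expansion_column)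
  also have "\<dots> = (\<Sum>p<n. if p = i then A $$ (p, j) * cofactor A p j else 0)"
    using assms(4) by (intro sum.cong) auto
  finally show ?thesis
    using assms(2) by simp
qed

text \<open>The all-ones vector is a nonzero kernel vector of the transpose; over an integral domain
  this forces the determinant to vanish.\<close>

lemma det_eq_0_if_col_sums_0:
  fixes A :: "'a :: idom mat"
  assumes A: "A \<in> carrier_mat n n" and "0 < n"
    and sums: "\<And>j. j < n \<Longrightarrow> (\<Sum>i<n. A $$ (i, j)) = 0"
  shows "det A = 0"
proof -
  let ?v = "vec n (\<lambda>_. 1) :: 'a vec"
  have "A\<^sup>T *\<^sub>v ?v = 0\<^sub>v n"
    using A sums by (intro eq_vecI) (auto simp: scalar_prod_def atLeast0LessThan)
  moreover have "?v \<noteq> 0\<^sub>v n"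
    using \<open>0 < n\<close> by (metis index_vec index_zero_vec(1) zero_neq_one)
  ultimately have "det (A\<^sup>T) = 0"
    using det_0_iff_vec_prod_zero[of "A\<^sup>T" n] A by (meson transpose_carrier_mat vec_carrier)
  then show ?thesis
    using det_transpose[OF A] by simp
qed

text \<open>\<open>insert_index k\<close> enumerates the naturals other than \<open>k\<close> in
  increasing order, so composing a choice of rows or columns with it drops the \<open>k\<close>-th
  chosen one. This lemma and the next two make the shortened choice admissible for the
  induction.\<close>

lemma insert_index_image_subset: "insert_index k ` {..<m} \<subseteq> {..<Suc m}"
  by (auto simp: insert_index_def)

lemma image_comp_insert_index_subset:
  "f ` {..<Suc m} \<subseteq> S \<Longrightarrow> (f \<circ> insert_index k) ` {..<m} \<subseteq> S"
  using insert_index_image_subset[of k m] by (auto simp: image_subset_iff)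

lemma inj_on_comp_insert_index:
  "inj_on f {..<Suc m} \<Longrightarrow> inj_on (f \<circ> insert_index k) {..<m}"
  by (rule comp_inj_on[OF insert_index_inj_on]) (rule inj_on_subset[OF _ insert_index_image_subset])

text \<open>\<open>F\<close> collects the rows of incidence type: within them a column takes each of
  the values 1 and -1 at most once. The rows outside \<open>F\<close> play the part of variable
  bounds and may repeat one another, as the two bounds of a one-way arc do. The induction is on the
  size of the submatrix.\<close>

lemma totally_unimodular_network_and_unit_rows:
  assumes entries: "\<And>r c. r \<in> R \<Longrightarrow> c \<in> C \<Longrightarrow> M r c \<in> {-1, 0, 1}"
    and unit: "\<And>r c c'. r \<in> R \<Longrightarrow> r \<notin> F \<Longrightarrow> c \<in> C \<Longrightarrow> c' \<in> C \<Longrightarrow>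
      M r c \<noteq> 0 \<Longrightarrow> M r c' \<noteq> 0 \<Longrightarrow> c = c'"
    and network: "\<And>r r' c. r \<in> R \<inter> F \<Longrightarrow> r' \<in> R \<inter> F \<Longrightarrow> c \<in> C \<Longrightarrow>
      M r c \<noteq> 0 \<Longrightarrow> M r' c = M r c \<Longrightarrow> r = r'"
  shows "totally_unimodular R C M"
proof -
  have "det (mat n n (\<lambda>(p, q). M (rs p) (cs q))) \<in> {-1, 0, 1}"
    if "rs ` {..<n} \<subseteq> R" "inj_on rs {..<n}" "cs ` {..<n} \<subseteq> C" "inj_on cs {..<n}" for n rs cs
    using that
  proof (induction n arbitrary: rs cs)
    case 0
    then show ?case by simp
  next
    case (Suc m)
    let ?n = "Suc m"
    let ?A = "mat ?n ?n (\<lambda>(p, q). M (rs p) (cs q))"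
    have rsR: "rs p \<in> R" and csC: "cs p \<in> C" if "p < ?n" for p
      using Suc.prems that by auto
    have rs_inj: "p = p'" if "rs p = rs p'" "p < ?n" "p' < ?n" for p p'
      using Suc.prems(2) that by (auto dest: inj_onD)
    have cs_inj: "q = q'" if "cs q = cs q'" "q < ?n" "q' < ?n" for q q'
      using Suc.prems(4) that by (auto dest: inj_onD)
    \<comment> \<open>Shared end of the row and column cases: the minor is again a submatrix of
      \<open>M\<close>, so its determinant is covered by the induction hypothesis.\<close>
    have expand: ?case
      if "i < ?n" "j < ?n" and det: "det ?A = ?A $$ (i, j) * cofactor ?A i j" for i j
    proof -
      have "mat_delete ?A i j = mat m m (\<lambda>(p, q). M (rs (insert_index i p)) (cs (insert_index j q)))"
        by (rule eq_matI) (auto simp: mat_delete_def insert_index_def)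
      moreover have "det (mat m m (\<lambda>(p, q). M ((rs \<circ> insert_index i) p) ((cs \<circ> insert_index j) q)))
          \<in> {-1, 0, 1}"
        using Suc.prems
        by (intro Suc.IH image_comp_insert_index_subset inj_on_comp_insert_index)
      ultimately have "det (mat_delete ?A i j) \<in> {-1, 0, 1}"
        by simp
      then have "cofactor ?A i j \<in> {-1, 0, 1}"
        by (cases "even (i + j)") (auto simp: cofactor_def)
      moreover have "?A $$ (i, j) \<in> {-1, 0, 1}"
        using that(1,2) entries[OF rsR csC] by simp
      ultimately show ?thesis
        unfolding det by auto
    qed
    show ?case
    \<comment> \<open>Zero rows and zero columns fall under this case too, since the entry at
      \<open>(i, j)\<close> may itself be 0.\<close>
    proof (cases "\<exists>i<?n. \<exists>j<?n. (\<forall>q<?n. q \<noteq> j \<longrightarrow> M (rs i) (cs q) = 0) \<or>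
        (\<forall>p<?n. p \<noteq> i \<longrightarrow> M (rs p) (cs j) = 0)")
      case True
      then obtain i j where ij: "i < ?n" "j < ?n"
        and zeros: "(\<forall>q<?n. q \<noteq> j \<longrightarrow> M (rs i) (cs q) = 0) \<or> (\<forall>p<?n. p \<noteq> i \<longrightarrow> M (rs p) (cs j) = 0)"
        by blast
      from zeros have "det ?A = ?A $$ (i, j) * cofactor ?A i j"
      proof
        assume "\<forall>q<?n. q \<noteq> j \<longrightarrow> M (rs i) (cs q) = 0"
        with ij show ?thesis
          by (intro det_eq_single_row_entry[where n = ?n]) auto
      next
        assume "\<forall>p<?n. p \<noteq> i \<longrightarrow> M (rs p) (cs j) = 0"
        with ij show ?thesis
          by (intro det_eq_single_col_entry[where n = ?n]) auto
      qed
      with ij show ?thesis by (rule expand)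
    next
      case False
      then have row: "\<exists>q<?n. q \<noteq> j \<and> M (rs i) (cs q) \<noteq> 0"
        and col: "\<exists>p<?n. p \<noteq> i \<and> M (rs p) (cs j) \<noteq> 0" if "i < ?n" "j < ?n" for i j
        using that by blast+
      \<comment> \<open>Every row now has nonzero entries in two different columns, which
        \<open>unit\<close> forbids outside \<open>F\<close>.\<close>
      have inF: "rs i \<in> R \<inter> F" if i: "i < ?n" for i
      proof -
        \<comment> \<open>The excluded column 0 is an arbitrary choice giving a first nonzero entry;
          excluding that entry's column then gives a second one.\<close>
        obtain q where q: "q < ?n" "M (rs i) (cs q) \<noteq> 0"
          using row[of i 0] i by auto
        then obtain q' where "q' < ?n" "q' \<noteq> q" "M (rs i) (cs q') \<noteq> 0"
          using row[of i q] i by auto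
        with q show ?thesis
          using unit[of "rs i" "cs q" "cs q'"] cs_inj rsR csC i by blast
      qed
      have sum_0: "(\<Sum>i<?n. M (rs i) (cs j)) = 0" if j: "j < ?n" for j
      proof -
        obtain p where p: "p < ?n" "M (rs p) (cs j) \<noteq> 0"
          using col[of 0 j] j by auto
        then obtain p' where p': "p' < ?n" "p' \<noteq> p" "M (rs p') (cs j) \<noteq> 0"
          using col[of p j] j by auto
        have entry: "M (rs i) (cs j) \<in> {-1, 0, 1}" if "i < ?n" for i
          using entries[OF rsR csC] that j by blast
        have distinct: "M (rs i) (cs j) \<noteq> M (rs i') (cs j)"
          if "i < ?n" "i' < ?n" "i \<noteq> i'" "M (rs i') (cs j) \<noteq> 0" for i i'
          using network[of "rs i'" "rs i" "cs j"] inF csC j rs_inj that by metis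
        \<comment> \<open>Two different nonzero values in {-1, 0, 1} can only be 1 and -1.\<close>
        have opposite: "M (rs p) (cs j) + M (rs p') (cs j) = 0"
          using entry[OF p(1)] entry[OF p'(1)] distinct[OF p'(1) p(1)] p p' by auto
        \<comment> \<open>Both nonzero values are already taken by rows \<open>p\<close> and
          \<open>p'\<close>, so \<open>network\<close> leaves only 0 for the other rows.\<close>
        have "M (rs i) (cs j) = 0" if "i < ?n" "i \<noteq> p" "i \<noteq> p'" for i
          using entry[OF that(1)] entry[OF p(1)] entry[OF p'(1)] distinct[of i p] distinct[of i p']
            opposite that p p' by auto
        then have "(\<Sum>i<?n. M (rs i) (cs j)) = (\<Sum>i\<in>{p, p'}. M (rs i) (cs j))"
          using p p' by (intro sum.mono_neutral_right) auto
        with p'(2) opposite show ?thesis by simp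
      qed
      \<comment> \<open>Removing \<open>sum.lessThan_Suc\<close> keeps the simplifier from splitting
        off the last summand, so that \<open>sum_0\<close> still matches.\<close>
      have "det ?A = 0"
        by (rule det_eq_0_if_col_sums_0[where n = ?n]) (use sum_0 in \<open>auto simp del: sum.lessThan_Suc\<close>)
      then show ?thesis by simp
    qed
  qed
  then show ?thesis
    unfolding totally_unimodular_def by blast
qed

theorem proposition1:
  fixes D :: "('i, 'k, 'w, 'a) sharing_data"
    and w :: 'w and z :: "'i \<Rightarrow> nat" and x :: "'i \<Rightarrow> 'k \<Rightarrow> nat"
  assumes "car_sharing D"
    and "w \<in> scenarios D"
    and "\<And>i. i \<in> regions D \<Longrightarrow> z i \<in> {0, 1}"
  shows "totally_unimodular
    (ip_rows (second_stage D w z x))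
    (ip_cols (second_stage D w z x))
    (ip_matrix (second_stage D w z x))"
proof -
  \<comment> \<open>The balance rows of all car types together form the incidence part; a column
    \<open>(a, l)\<close> meets only those of car type \<open>l\<close>.\<close>
  let ?F = "{Flow_Balance i k t | i k t. True} :: ('i, 'k, 'a) second_stage_row set"
  have "totally_unimodular (second_stage_rows D) (arcs (network D) \<times> car_types D)
      (second_stage_coeff D)"
  proof (rule totally_unimodular_network_and_unit_rows[where F = ?F])
    fix r :: "('i, 'k, 'a) second_stage_row" and c :: "'a \<times> 'k"
    show "second_stage_coeff D r c \<in> {-1, 0, 1}"
      by (cases r; cases c) auto
  next
    fix r :: "('i, 'k, 'a) second_stage_row" and c c' :: "'a \<times> 'k"
    assume "r \<notin> ?F" "second_stage_coeff D r c \<noteq> 0" "second_stage_coeff D r c' \<noteq> 0"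
    \<comment> \<open>A bound row for arc \<open>b\<close> and car type \<open>k\<close> is nonzero
      only at \<open>(b, k)\<close>.\<close>
    then show "c = c'"
      by (cases r) auto
  next
    fix r r' :: "('i, 'k, 'a) second_stage_row" and c :: "'a \<times> 'k"
    assume "r \<in> second_stage_rows D \<inter> ?F" "r' \<in> second_stage_rows D \<inter> ?F"
      and "second_stage_coeff D r c \<noteq> 0" "second_stage_coeff D r' c = second_stage_coeff D r c"
    \<comment> \<open>At column \<open>(a, l)\<close>, the value 1 forces the row's node to be the
      tail of \<open>a\<close> and -1 forces it to be the head; the car type is \<open>l\<close> in
      both cases. The value thus determines the row.\<close>
    then show "r = r'"
      by (cases c) (auto simp: of_bool_def split: if_splits)
  qed
  then show ?thesis
    by (simp add: second_stage_def)
qed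

end
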